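(* Let $S_0$ be the initial stock price, and define the indifference price of the ASR (Accelerated Share Repurchase) contract by $$\Pi:=\inf\left\{p\ \Big|\ \sup_{(v,n^{\star})\in\mathcal{A}}\mathbb{E}\left[-\exp\left(-\gamma\left(p+F-X^{0,0,v}_{n^{\star}}-\left(\frac{F}{A^{0,S_0,S_0}_{n^{\star}}}- q^{0,0,v}_{n^{\star}}\right)S^{0,S_0}_{n^{\star}} - \ell\left(\frac{F}{A^{0,S_0,S_0}_{n^{\star}}}- q^{0,0,v}_{n^{\star}}\right)\right)\right)\right]\geq -1\right\}.$$ Let $\theta_0$ be defined from the time-$0$ value function $u_0$ by $u_0(x,q,S)=-\exp\left(-\gamma\left(-x+qS-\theta_0(q,S)\right)\right)$. Then $$\Pi=\theta_0(0,S_0).$$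
   Context: Setting. Discrete-time model with time indices $0,\dots,N$ and time step $\delta t>0$. Let $(\Omega,(\mathcal{F}_n)_{0\le n\le N},\mathbb{P})$ be a filtered probability space whose filtration satisfies the usual assumptions; all random variables are defined on it. The random variables $(\epsilon_n)_n$ are i.i.d. with mean $0$, variance $1$ and a moment-generating function defined on $\mathbb{R}_+$, and $\epsilon_{n+1}$ is $\mathcal{F}_{n+1}$-measurable. $\sigma>0$ is the volatility parameter, $F>0$ the notional of the contract, $\gamma>0$ the absolute risk aversion parameter. The market volume process $(V_n)_n$ ($V_{n+1}\delta t$ is the market volume over the period between time indices $n$ and $n+1$) is $\mathcal{F}_0$-measurable. $\underline{\rho},\overline{\rho}$ are bounds on the participation rate ($\underline{\rho}$ can be of either sign). $\mathcal{N}\subset\{1,\dots,N-1\}$ is a non-empty set (time indices at which the option can be exercised early). The execution cost function $L:\mathbb{R}\to\mathbb{R}_+$ is continuous, strictly convex, even, increasing on $\mathbb{R}_+$, with $L(0)=0$ and $\lim_{\rho\to+\infty}L(\rho)/\rho=+\infty$. The penalty function is $\ell(q)=\frac{L(\rho)}{\rho}|q|+\frac{\gamma\sigma^2}{6\rho V}|q|^3$, where $\rho$ is a constant participation rate and $V$ is the average value of the market volume process. State variables started at time index $0$. For $1\le k\le N$: $$X_{k}^{0,x,v}=x+\sum_{j=0}^{k-1}\left(v_{j}S_{j+1}^{0,S}\delta t+L\left(\tfrac{v_{j}}{V_{j+1}}\right)V_{j+1}\delta t\right),\qquad q_{k}^{0,q,v}=q+\sum_{j=0}^{k-1}v_{j}\delta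 t,$$ $$S_{k}^{0,S}=S+\sigma\sqrt{\delta t}\sum_{j=0}^{k-1}\epsilon_{j+1},\qquad A_{k}^{0,A,S}=\frac{1}{k}\sum_{j=0}^{k-1}S_{j+1}^{0,S}$$ (the last one does not depend on $A$). Admissible strategies. $\mathcal{A}$ is the set of pairs $(v,n^\star)$ where $v=(v_n)_{0\le n\le n^\star-1}$ is $(\mathcal{F})$-adapted with $\underline{\rho}V_{n+1}\le v_n\le\overline{\rho}V_{n+1}$, and $n^\star$ is an $(\mathcal{F})$-stopping time taking values in $\mathcal{N}\cup\{N\}$. Value function at time $0$ (it does not depend on the variable $A$): $$u_{0}(x,q,S)= \sup_{(v,n^{\star})\in\mathcal{A}}\mathbb{E}\left[-\exp\left(-\gamma\left(F-X_{n^{\star}}^{0,x,v}-\left(\frac{F}{A^{0,A,S}_{n^{\star}}}- q^{0,q,v}_{n^{\star}}\right)S^{0,S}_{n^{\star}} - \ell\left(\frac{F}{A^{0,A,S}_{n^{\star}}}- q^{0,q,v}_{n^{\star}}\right)\right)\right)\right].$$ *)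

theory Defs
  imports "HOL-Probability.Probability"
begin

definition exp_ereal :: "ereal \<Rightarrow> ereal" where
  "exp_ereal x = (case x of ereal r \<Rightarrow> ereal (exp r) | PInfty \<Rightarrow> \<infinity> | MInfty \<Rightarrow> 0)"

lemma nn_integral_scale_le:
  fixes c :: ennreal
  shows "c * integral\<^sup>N M f \<le> (\<integral>\<^sup>+ \<omega>. c * f \<omega> \<partial>M)"
proof -
  have "c * integral\<^sup>S M g \<le> (\<integral>\<^sup>+ \<omega>. c * f \<omega> \<partial>M)" if g: "simple_function M g" "g \<le> f" for g
  proof -
    have "c * integral\<^sup>S M g = (\<integral>\<^sup>+ \<omega>. c * g \<omega> \<partial>M)"
      using g(1) by (simp add: nn_integral_eq_simple_integral[symmetric] nn_integral_cmult
          borel_measurable_simple_function)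
    also have "\<dots> \<le> (\<integral>\<^sup>+ \<omega>. c * f \<omega> \<partial>M)"
      using g(2) by (intro nn_integral_mono mult_left_mono) (auto simp: le_fun_def)
    finally show ?thesis .
  qed
  then show ?thesis
    unfolding nn_integral_def[of M f] SUP_mult_left_ennreal by (auto intro!: SUP_least)
qed

lemma nn_integral_scale:
  fixes f :: "'a \<Rightarrow> ennreal"
  assumes "r > 0"
  shows "(\<integral>\<^sup>+ \<omega>. ennreal r * f \<omega> \<partial>M) = ennreal r * integral\<^sup>N M f"
proof (rule antisym)
  have inv: "ennreal (1 / r) * ennreal r = 1" "ennreal r * ennreal (1 / r) = 1"
    using assms by (simp_all flip: ennreal_mult)
  have "ennreal (1 / r) * (\<integral>\<^sup>+ \<omega>. ennreal r * f \<omega> \<partial>M)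
      \<le> (\<integral>\<^sup>+ \<omega>. ennreal (1 / r) * (ennreal r * f \<omega>) \<partial>M)"
    by (rule nn_integral_scale_le)
  also have "\<dots> = integral\<^sup>N M f"
    by (simp add: inv mult.assoc[symmetric])
  finally have "ennreal r * (ennreal (1 / r) * (\<integral>\<^sup>+ \<omega>. ennreal r * f \<omega> \<partial>M))
      \<le> ennreal r * integral\<^sup>N M f"
    by (rule mult_left_mono) simp
  then show "(\<integral>\<^sup>+ \<omega>. ennreal r * f \<omega> \<partial>M) \<le> ennreal r * integral\<^sup>N M f"
    by (simp add: inv mult.assoc[symmetric])
qed (rule nn_integral_scale_le)

lemma exp_ereal_affine_ex1:
  assumes "g > 0" "y \<ge> 0"
  shows "\<exists>!t. y = exp_ereal (ereal (- g) * (ereal a - t))"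
proof -
  have ex: "\<exists>t. y = exp_ereal (ereal (- g) * (ereal a - t))"
  proof (cases y)
    case PInf
    then show ?thesis using assms by (intro exI[of _ \<infinity>]) (simp add: exp_ereal_def)
  next
    case (real r)
    show ?thesis
    proof (cases "r = 0")
      case True
      then show ?thesis using assms real
        by (intro exI[of _ "-\<infinity>"]) (simp add: exp_ereal_def zero_ereal_def)
    next
      case False
      then show ?thesis using assms real
        by (intro exI[of _ "ereal (a + ln r / g)"]) (simp add: exp_ereal_def zero_ereal_def)
    qed
  qed (use assms in auto)
  moreover have "t = s"
    if "exp_ereal (ereal (- g) * (ereal a - t)) = exp_ereal (ereal (- g) * (ereal a - s))" for t s
    using that assms
    by (cases t; cases s) (auto simp: exp_ereal_def zero_ereal_def)
  ultimately show ?thesis by metis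
qed

locale asr_model = prob_space M + complete_measure M + filtration "space M" \<F>
  for M :: "'a measure"
    and \<F> :: "nat \<Rightarrow> 'a measure" +
  fixes N :: nat
    and dt :: real
    and eps :: "nat \<Rightarrow> 'a \<Rightarrow> real"
    and sigma :: real
    and V :: "nat \<Rightarrow> 'a \<Rightarrow> real"
    and rho_lo rho_hi :: real
    and Ex :: "nat set"  \<comment> \<open>dates at which early exercise is allowed\<close>
    and L :: "real \<Rightarrow> real"
    and rho :: real
    and F :: real
    and gamma :: real
  \<comment> \<open>The filtration is indexed by all of \<open>nat\<close>, but only \<open>\<F> 0, \<dots>, \<F> N\<close> matter.
    In discrete time the usual assumptions amount to completeness; right-continuity is void.
    The signs of \<open>V\<close> and \<open>rho\<close> and the order of \<open>rho_lo\<close>, \<open>rho_hi\<close> are left unconstrained.\<close>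
  assumes sets_filtration: "\<And>n. sets (\<F> n) \<subseteq> sets M"
    and null_sets_filtration: "null_sets M \<subseteq> sets (\<F> 0)"
    and dt_pos: "dt > 0"
    and eps_measurable: "\<And>n. n < N \<Longrightarrow> eps (Suc n) \<in> borel_measurable (\<F> (Suc n))"
    and eps_indep: "indep_vars (\<lambda>_. borel) eps {1..N}"
    and eps_ident: "\<And>i j. i \<in> {1..N} \<Longrightarrow> j \<in> {1..N} \<Longrightarrow> distr M borel (eps i) = distr M borel (eps j)"
    and eps_integrable: "\<And>n. n \<in> {1..N} \<Longrightarrow> integrable M (eps n)"
    and eps_mean: "\<And>n. n \<in> {1..N} \<Longrightarrow> expectation (eps n) = 0"
    and eps_sq_integrable: "\<And>n. n \<in> {1..N} \<Longrightarrow> integrable M (\<lambda>\<omega>. (eps n \<omega>)\<^sup>2)"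
    and eps_variance: "\<And>n. n \<in> {1..N} \<Longrightarrow> variance (eps n) = 1"
    and eps_mgf: "\<And>n t. n \<in> {1..N} \<Longrightarrow> t \<ge> 0 \<Longrightarrow> integrable M (\<lambda>\<omega>. exp (t * eps n \<omega>))"
    and sigma_pos: "sigma > 0"
    and V_measurable: "\<And>n. n \<in> {1..N} \<Longrightarrow> V n \<in> borel_measurable (\<F> 0)"
    and Ex_nonempty: "Ex \<noteq> {}"
    and Ex_subset: "Ex \<subseteq> {1..N - 1}"
    and L_nonneg: "\<And>r. L r \<ge> 0"
    and L_continuous: "continuous_on UNIV L"
    and L_strictly_convex:
      "\<And>r s t. r \<noteq> s \<Longrightarrow> 0 < t \<Longrightarrow> t < 1 \<Longrightarrow> L ((1 - t) * r + t * s) < (1 - t) * L r + t * L s"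
    and L_even: "\<And>r. L (- r) = L r"
    and L_increasing: "strict_mono_on {0..} L"
    and L_zero: "L 0 = 0"
    and L_superlinear: "filterlim (\<lambda>r. L r / r) at_top at_top"
    and F_pos: "F > 0"
    and gamma_pos: "gamma > 0"
begin

definition Vavg :: "'a \<Rightarrow> real" where
  "Vavg \<omega> = (\<Sum>n=1..N. V n \<omega>) / real N"

text \<open>The penalty depends on \<open>\<omega>\<close> only through the average market volume, which is known at time \<open>0\<close>.\<close>

definition penalty :: "'a \<Rightarrow> real \<Rightarrow> real" where
  "penalty \<omega> q = L rho / rho * \<bar>q\<bar> + gamma * sigma\<^sup>2 / (6 * rho * Vavg \<omega>) * \<bar>q\<bar> ^ 3"

definition stock :: "real \<Rightarrow> nat \<Rightarrow> 'a \<Rightarrow> real" where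
  "stock S k \<omega> = S + sigma * sqrt dt * (\<Sum>j<k. eps (Suc j) \<omega>)"

definition avg_price :: "real \<Rightarrow> nat \<Rightarrow> 'a \<Rightarrow> real" where
  "avg_price S k \<omega> = (\<Sum>j<k. stock S (Suc j) \<omega>) / real k"

definition shares :: "real \<Rightarrow> (nat \<Rightarrow> 'a \<Rightarrow> real) \<Rightarrow> nat \<Rightarrow> 'a \<Rightarrow> real" where
  "shares q v k \<omega> = q + (\<Sum>j<k. v j \<omega> * dt)"

definition cash_spent :: "real \<Rightarrow> real \<Rightarrow> (nat \<Rightarrow> 'a \<Rightarrow> real) \<Rightarrow> nat \<Rightarrow> 'a \<Rightarrow> real" where
  "cash_spent x S v k \<omega> = x + (\<Sum>j<k. v j \<omega> * stock S (Suc j) \<omega> * dt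
     + L (v j \<omega> / V (Suc j) \<omega>) * V (Suc j) \<omega> * dt)"

text \<open>A strategy is only defined up to the exercise date, so \<open>v n\<close> is constrained (measurability
  and participation bounds) only on the event \<open>n < nstar\<close>.\<close>

definition admissible :: "((nat \<Rightarrow> 'a \<Rightarrow> real) \<times> ('a \<Rightarrow> nat)) set" where
  "admissible = {(v, nstar).
     stopping_time \<F> nstar \<and>
     (\<forall>\<omega>\<in>space M. nstar \<omega> \<in> Ex \<union> {N}) \<and>
     (\<forall>n<N. v n \<in> borel_measurable (restrict_space (\<F> n) {\<omega>\<in>space M. n < nstar \<omega>})) \<and>
     (\<forall>n<N. AE \<omega> in M. n < nstar \<omega> \<longrightarrow>
        rho_lo * V (Suc n) \<omega> \<le> v n \<omega> \<and> v n \<omega> \<le> rho_hi * V (Suc n) \<omega>)}"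

definition payoff ::
  "real \<Rightarrow> real \<Rightarrow> real \<Rightarrow> (nat \<Rightarrow> 'a \<Rightarrow> real) \<Rightarrow> ('a \<Rightarrow> nat) \<Rightarrow> 'a \<Rightarrow> real" where
  "payoff x q S v nstar \<omega> =
     (let k = nstar \<omega>; r = F / avg_price S k \<omega> - shares q v k \<omega>
      in F - cash_spent x S v k \<omega> - r * stock S k \<omega> - penalty \<omega> r)"

text \<open>Expectation of \<open>- exp (- gamma * W)\<close> with values in \<open>[-\<infinity>, 0]\<close>. The Bochner integral would
  assign \<open>0\<close>, the largest utility, to strategies with non-integrable disutility.\<close>

definition expected_utility :: "('a \<Rightarrow> real) \<Rightarrow> ereal" where
  "expected_utility W = - enn2ereal (\<integral>\<^sup>+ \<omega>. ennreal (exp (- gamma * W \<omega>)) \<partial>M)"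

definition u0 :: "real \<Rightarrow> real \<Rightarrow> real \<Rightarrow> ereal" where
  "u0 x q S = (SUP (v, nstar) \<in> admissible. expected_utility (payoff x q S v nstar))"

definition indifference_price :: "real \<Rightarrow> ereal" where
  "indifference_price S0 = Inf {ereal p | p :: real.
     (SUP (v, nstar) \<in> admissible. expected_utility (\<lambda>\<omega>. p + payoff 0 0 S0 v nstar \<omega>)) \<ge> - 1}"

lemma expected_utility_shift:
  "expected_utility (\<lambda>\<omega>. c + W \<omega>) = ereal (exp (- gamma * c)) * expected_utility W"
proof -
  have "(\<integral>\<^sup>+ \<omega>. ennreal (exp (- gamma * (c + W \<omega>))) \<partial>M)
      = (\<integral>\<^sup>+ \<omega>. ennreal (exp (- gamma * c)) * ennreal (exp (- gamma * W \<omega>)) \<partial>M)"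
    by (simp add: ring_distribs exp_add[symmetric] flip: ennreal_mult)
  also have "\<dots> = ennreal (exp (- gamma * c)) * (\<integral>\<^sup>+ \<omega>. ennreal (exp (- gamma * W \<omega>)) \<partial>M)"
    by (rule nn_integral_scale) simp
  finally show ?thesis
    by (simp add: expected_utility_def times_ennreal.rep_eq enn2ereal_ennreal)
qed

lemma payoff_shift: "payoff x q S v nstar = (\<lambda>\<omega>. - x + payoff 0 q S v nstar \<omega>)"
  by (auto simp: payoff_def cash_spent_def Let_def)

lemma u0_shift: "u0 x q S = ereal (exp (gamma * x)) * u0 0 q S"
proof (cases "admissible = {}")
  case True
  then show ?thesis by (simp add: u0_def bot_ereal_def)
next
  case False
  have "u0 x q S = (SUP p \<in> admissible. ereal (exp (gamma * x)) *
      (case p of (v, nstar) \<Rightarrow> expected_utility (payoff 0 q S v nstar)))"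
    unfolding u0_def
    by (rule SUP_cong) (auto simp: payoff_shift[of x] expected_utility_shift
        simp del: add_uminus_conv_diff uminus_add_conv_diff)
  also have "\<dots> = ereal (exp (gamma * x)) * u0 0 q S"
    unfolding u0_def
  proof (rule antisym)
    let ?g = "\<lambda>p. case p of (v, nstar) \<Rightarrow> expected_utility (payoff 0 q S v nstar)"
    let ?c = "exp (gamma * x)"
    show "(SUP p \<in> admissible. ereal ?c * ?g p) \<le> ereal ?c * (SUP p \<in> admissible. ?g p)"
      by (intro SUP_least ereal_mult_left_mono SUP_upper) auto
    have "(SUP p \<in> admissible. ?g p) \<le> (SUP p \<in> admissible. ereal ?c * ?g p) / ereal ?c"
      by (intro SUP_least) (auto simp: ereal_le_divide_pos intro!: SUP_upper2)
    then show "ereal ?c * (SUP p \<in> admissible. ?g p) \<le> (SUP p \<in> admissible. ereal ?c * ?g p)"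
      by (subst (asm) ereal_le_divide_pos) auto
  qed
  finally show ?thesis .
qed

lemma u0_nonpos: "u0 x q S \<le> 0"
  unfolding u0_def by (rule SUP_least) (auto simp: expected_utility_def)

lemma exp_ereal_shift:
  "exp_ereal (ereal (- gamma) * (ereal (- x + a) - t))
    = ereal (exp (gamma * x)) * exp_ereal (ereal (- gamma) * (ereal a - t))"
  using gamma_pos by (cases t) (auto simp: exp_ereal_def exp_add[symmetric] algebra_simps)

lemma theta0_ex1:
  "\<exists>!\<theta>. \<forall>x q S. u0 x q S = - exp_ereal (ereal (- gamma) * (ereal (- x + q * S) - \<theta> q S))"
proof -
  let ?P = "\<lambda>q S t. - u0 0 q S = exp_ereal (ereal (- gamma) * (ereal (q * S) - t))"
  let ?Q = "\<lambda>x q S t. u0 x q S = - exp_ereal (ereal (- gamma) * (ereal (- x + q * S) - t))"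
  have PQ: "?Q x q S t" if "?P q S t" for x q S t
  proof -
    have "u0 x q S = ereal (exp (gamma * x)) * u0 0 q S"
      by (rule u0_shift)
    also have "u0 0 q S = - exp_ereal (ereal (- gamma) * (ereal (q * S) - t))"
      using that by (metis ereal_uminus_uminus)
    finally show ?thesis
      by (simp only: exp_ereal_shift ereal_mult_minus_right)
  qed
  have QP: "?P q S t" if "?Q 0 q S t" for q S t
    using that by simp
  have ex1: "\<exists>!t. ?P q S t" for q S
    using u0_nonpos[of 0 q S] gamma_pos
    by (intro exp_ereal_affine_ex1) (auto simp: ereal_uminus_le_reorder)
  then obtain \<theta> where \<theta>: "\<And>q S. ?P q S (\<theta> q S)"
    by metis
  show ?thesis
  proof (rule ex1I[of _ \<theta>])
    show "\<forall>x q S. ?Q x q S (\<theta> q S)"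
      using PQ \<theta> by blast
  next
    fix \<eta> assume "\<forall>x q S. ?Q x q S (\<eta> q S)"
    then have "?P q S (\<eta> q S)" for q S
      using QP by blast
    with ex1 \<theta> show "\<eta> = \<theta>"
      by (intro ext) blast
  qed
qed

text \<open>Extended-real valued, since \<open>u0\<close> may take the values \<open>-\<infinity>\<close> (where \<open>theta0 = \<infinity>\<close>) and \<open>0\<close>.
  Existence and uniqueness are shown above.\<close>

definition theta0 :: "real \<Rightarrow> real \<Rightarrow> ereal" where
  "theta0 = (THE \<theta>. \<forall>x q S. u0 x q S =
     - exp_ereal (ereal (- gamma) * (ereal (- x + q * S) - \<theta> q S)))"

end

end

theory Submission
  imports Defs
begin

text \<open>Cash invariance: adding \<open>p\<close> to the payoff is the same as starting from cash spent \<open>- p\<close>, so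
  the condition defining the indifference price reads \<open>u0 (- p) 0 S0 \<ge> - 1\<close>, i.e.
  \<open>exp (- gamma * (p - \<theta>)) \<le> 1\<close> with \<open>\<theta> = theta0 0 S0\<close>, i.e. \<open>p \<ge> \<theta>\<close>.\<close>

lemma exp_ereal_le_one_iff: "exp_ereal x \<le> 1 \<longleftrightarrow> x \<le> 0"
  by (cases x) (auto simp: exp_ereal_def zero_ereal_def one_ereal_def)

text \<open>Real upper bounds determine an extended real: at \<open>\<infinity>\<close> there are
  none and the empty infimum is \<open>\<infinity>\<close>; at \<open>-\<infinity>\<close> every
  real is one.\<close>

lemma Inf_ereal_reals_ge: "Inf {ereal p | p. t \<le> ereal p} = t"
proof (rule antisym)
  show "Inf {ereal p | p. t \<le> ereal p} \<le> t"
    by (rule ereal_le_real) (auto intro!: Inf_lower)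
qed (auto intro: Inf_greatest)

context asr_model
begin

text \<open>Unique existence lets the definite description \<open>theta0\<close> inherit its
  defining equation.\<close>

lemma u0_eq_theta0:
  "u0 x q S = - exp_ereal (ereal (- gamma) * (ereal (- x + q * S) - theta0 q S))"
  using theI'[OF theta0_ex1] unfolding theta0_def by blast

lemma indifference_price_condition:
  "(SUP (v, nstar) \<in> admissible. expected_utility (\<lambda>\<omega>. p + payoff 0 q S v nstar \<omega>)) = u0 (- p) q S"
  by (simp add: u0_def payoff_shift[of "- p"])

lemma u0_ge_minus_one_iff: "u0 (- p) 0 S \<ge> - 1 \<longleftrightarrow> theta0 0 S \<le> ereal p"
proof -
  have "u0 (- p) 0 S \<ge> - 1 \<longleftrightarrow> ereal (- gamma) * (ereal p - theta0 0 S) \<le> 0"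
    by (simp add: u0_eq_theta0 exp_ereal_le_one_iff)
  also have "\<dots> \<longleftrightarrow> theta0 0 S \<le> ereal p"
    \<comment> \<open>Infinite values agree as well: both sides fail at \<open>\<infinity>\<close>
      and hold at \<open>-\<infinity>\<close>.\<close>
    using gamma_pos by (cases "theta0 0 S") (auto simp: zero_le_mult_iff)
  finally show ?thesis .
qed

lemma indifference_price_eq_theta0: "indifference_price S = theta0 0 S"
  by (simp add: indifference_price_def indifference_price_condition u0_ge_minus_one_iff
      Inf_ereal_reals_ge)

end

theorem proposition3:
  fixes M :: "'a measure" and \<F> :: "nat \<Rightarrow> 'a measure" and N :: nat and dt :: real
    and eps :: "nat \<Rightarrow> 'a \<Rightarrow> real" and sigma :: real and V :: "nat \<Rightarrow> 'a \<Rightarrow> real"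
    and rho_lo rho_hi :: real and Ex :: "nat set" and L :: "real \<Rightarrow> real"
    and rho F gamma S0 :: real
  assumes "asr_model M \<F> N dt eps sigma V Ex L F gamma"
  shows "asr_model.indifference_price M \<F> N dt eps sigma V rho_lo rho_hi Ex L rho F gamma S0 =
    asr_model.theta0 M \<F> N dt eps sigma V rho_lo rho_hi Ex L rho F gamma 0 S0"
  using assms by (rule asr_model.indifference_price_eq_theta0)

end
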